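(* Let $k,m,n$ be positive integers with $m\le n$, let $\delta\in(0,\tfrac13)$, $\mu>0$, and let $\mathbf B\in\mathbb R^{n\times k}$ satisfy the R-RIP over $\mathcal H-\mathcal H$ with parameter $\delta$ and precision $\mu$. Let $\check{\mathbf y}\in\mathbb R^k$, $\check{\mathbf S}\in\mathcal S$, $\check{\mathbf H}=\check{\mathbf y}^T\otimes\check{\mathbf S}$, and assume that $$(1-\delta)\|\mathbf H-\check{\mathbf H}\|_F^2\le\|(\mathbf H-\check{\mathbf H})\mathbb b\|^2\le(1+\delta)\|\mathbf H-\check{\mathbf H}\|_F^2\qquad\text{for all }\mathbf H\in\mathcal H.$$ Let $\varsigma=\sqrt{\frac{1+\delta}{1-\delta}}$ and $$\nu_{\min}(\varsigma)=\frac{1-\varsigma^2+2\sqrt{\varsigma^2-1}}{1+\varsigma^2-2\sqrt{\varsigma^2-1}}.$$ Then $\nu_{\min}(\varsigma)\to0$ as $\delta\to0$ (equivalently $\varsigma\to1$). Moreover, let $\check{\mathbf x}=\check{\mathbf S}\mathbf B\check{\mathbf y}$ be the noiseless unlabeled samples and let $\mathbf S^1\mapsto\mathbf y^1\mapsto\mathbf S^2\mapsto\mathbf y^2\mapsto\cdots$ be a sequence generated by AltMin for the input $\check{\mathbf x}$, started from $\mathbf S^1\in\mathcal S$ with $\nu_{\mathbf S^1,\check{\mathbf S}}>\nu_{\min}(\varsigma)$. Then $\lim_{t\to\infty}\|\check{\mathbf y}-\mathbf y^t\|=0$.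
   Context: $\mathcal S$ is the set of ordered selection matrices: $m\times n$ matrices $\mathbf S$ with entries in $\{0,1\}$ for which there are indices $1\le i_1<\dots<i_m\le n$ with $\mathbf S_{l,p}=1$ if $p=i_l$ and $0$ otherwise. $\mathcal H=\{\mathbf y^{T}\otimes\mathbf S:\mathbf y\in\mathbb R^k,\mathbf S\in\mathcal S\}$ (Kronecker product), $\mathbb b=\mathrm{vec}(\mathbf B)$ (columns stacked), so $(\mathbf y^T\otimes\mathbf S)\mathbb b=\mathbf S\mathbf B\mathbf y$. $\|\cdot\|$ is the Euclidean norm and $\|\cdot\|_F$ the Frobenius norm. R-RIP over $\mathcal H-\mathcal H$ with parameter $\delta$ and precision $\mu$: $(1-\delta)\|\mathbf H-\mathbf H'\|_F^2\le\|(\mathbf H-\mathbf H')\mathbb b\|^2\le(1+\delta)\|\mathbf H-\mathbf H'\|_F^2$ for all $\mathbf H,\mathbf H'\in\mathcal H$ with $\|\mathbf H-\mathbf H'\|_F\ge\mu\max\{\|\mathbf H\|_F,\|\mathbf H'\|_F\}$. Similarity: $\nu_{\mathbf S,\mathbf S'}=\frac1m\mathrm{tr}(\mathbf S^T\mathbf S')\in[0,1]$, the fraction of common rows of $\mathbf S,\mathbf S'\in\mathcal S$. AltMin on input $\check{\mathbf x}\in\mathbb R^m$: with $f(\mathbf S,\mathbf y)=\|\check{\mathbf x}-\mathbf S\mathbf B\mathbf y\|^2$ and a given $\mathbf S^1\in\mathcal S$, for $t=1,2,\dots$ take $\mathbf y^t\in\arg\min_{\mathbf y\in\mathbb R^k}f(\mathbf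 S^t,\mathbf y)$ and $\mathbf S^{t+1}\in\arg\min_{\mathbf S\in\mathcal S}f(\mathbf S,\mathbf y^t)$. *)

theory Defs
  imports Complex_Main "Jordan_Normal_Form.Matrix"
begin

definition euclid_norm :: "real vec \<Rightarrow> real" where
  "euclid_norm v = sqrt (v \<bullet> v)"

definition frobenius_norm :: "real mat \<Rightarrow> real" where
  "frobenius_norm A = sqrt (\<Sum>i<dim_row A. \<Sum>j<dim_col A. (A $$ (i, j))\<^sup>2)"

definition mat_trace :: "real mat \<Rightarrow> real" where
  "mat_trace A = (\<Sum>i<dim_row A. A $$ (i, i))"

definition kronecker :: "real mat \<Rightarrow> real mat \<Rightarrow> real mat" (infixl "\<otimes>\<^sub>k" 70) where
  "A \<otimes>\<^sub>k C = mat (dim_row A * dim_row C) (dim_col A * dim_col C)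
     (\<lambda>(i, j). A $$ (i div dim_row C, j div dim_col C) * C $$ (i mod dim_row C, j mod dim_col C))"

text \<open>Vectorization stacks the columns: entry \<open>j * dim_row A + i\<close> is \<open>A $$ (i, j)\<close>.\<close>

definition vectorize :: "real mat \<Rightarrow> real vec" where
  "vectorize A = vec (dim_row A * dim_col A) (\<lambda>p. A $$ (p mod dim_row A, p div dim_row A))"

text \<open>Rows and columns are numbered from 0, as in the matrix library.\<close>

definition selection_matrices :: "nat \<Rightarrow> nat \<Rightarrow> real mat set" where
  "selection_matrices m n =
     {S. \<exists>idx :: nat \<Rightarrow> nat. strict_mono_on {..<m} idx \<and> idx ` {..<m} \<subseteq> {..<n} \<and>
         S = mat m n (\<lambda>(l, p). if p = idx l then 1 else 0)}"

definition H_set :: "nat \<Rightarrow> nat \<Rightarrow> nat \<Rightarrow> real mat set" where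
  "H_set k m n =
     {mat_of_row y \<otimes>\<^sub>k S | y S. y \<in> carrier_vec k \<and> S \<in> selection_matrices m n}"

text \<open>Restricted isometry property of the vector \<open>b\<close> over the difference set \<open>\<H> - \<H>\<close>,
  imposed only on pairs whose relative distance is at least the precision \<open>\<mu>\<close>.\<close>

definition R_RIP :: "real mat set \<Rightarrow> real vec \<Rightarrow> real \<Rightarrow> real \<Rightarrow> bool" where
  "R_RIP \<H> b \<delta> \<mu> \<longleftrightarrow>
     (\<forall>H\<in>\<H>. \<forall>H'\<in>\<H>.
        frobenius_norm (H - H') \<ge> \<mu> * max (frobenius_norm H) (frobenius_norm H') \<longrightarrow>
        (1 - \<delta>) * (frobenius_norm (H - H'))\<^sup>2 \<le> (euclid_norm ((H - H') *\<^sub>v b))\<^sup>2 \<and>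
        (euclid_norm ((H - H') *\<^sub>v b))\<^sup>2 \<le> (1 + \<delta>) * (frobenius_norm (H - H'))\<^sup>2)"

definition similarity :: "nat \<Rightarrow> real mat \<Rightarrow> real mat \<Rightarrow> real" where
  "similarity m S S' = mat_trace (S\<^sup>T * S') / real m"

definition altmin_cost :: "real mat \<Rightarrow> real vec \<Rightarrow> real mat \<Rightarrow> real vec \<Rightarrow> real" where
  "altmin_cost B x S y = (euclid_norm (x - S *\<^sub>v (B *\<^sub>v y)))\<^sup>2"

text \<open>The iterates are indexed by \<open>t \<ge> 1\<close>; the values at \<open>t = 0\<close> are irrelevant. Any choice
  among several minimizers is allowed.\<close>

definition altmin_sequence ::
  "nat \<Rightarrow> nat \<Rightarrow> nat \<Rightarrow> real mat \<Rightarrow> real vec \<Rightarrow> (nat \<Rightarrow> real mat) \<Rightarrow> (nat \<Rightarrow> real vec) \<Rightarrow> bool" where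
  "altmin_sequence k m n B x S y \<longleftrightarrow>
     S 1 \<in> selection_matrices m n \<and>
     (\<forall>t\<ge>1. is_arg_min (\<lambda>z. altmin_cost B x (S t) z) (\<lambda>z. z \<in> carrier_vec k) (y t) \<and>
            is_arg_min (\<lambda>T. altmin_cost B x T (y t)) (\<lambda>T. T \<in> selection_matrices m n) (S (t + 1)))"

definition varsigma :: "real \<Rightarrow> real" where
  "varsigma \<delta> = sqrt ((1 + \<delta>) / (1 - \<delta>))"

definition nu_min :: "real \<Rightarrow> real" where
  "nu_min s = (1 - s\<^sup>2 + 2 * sqrt (s\<^sup>2 - 1)) / (1 + s\<^sup>2 - 2 * sqrt (s\<^sup>2 - 1))"

lemma kronecker_row_mult_vectorize:
  assumes "y \<in> carrier_vec k" and "S \<in> carrier_mat m n" and "B \<in> carrier_mat n k"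
  shows "(mat_of_row y \<otimes>\<^sub>k S) *\<^sub>v vectorize B = S *\<^sub>v (B *\<^sub>v y)"
proof (rule eq_vecI)
  show "dim_vec ((mat_of_row y \<otimes>\<^sub>k S) *\<^sub>v vectorize B) = dim_vec (S *\<^sub>v (B *\<^sub>v y))"
    using assms by (simp add: kronecker_def mat_of_row_def)
next
  fix i assume "i < dim_vec (S *\<^sub>v (B *\<^sub>v y))"
  then have i: "i < m" using assms by simp
  have "((mat_of_row y \<otimes>\<^sub>k S) *\<^sub>v vectorize B) $ i =
      (\<Sum>p<k * n. y $ (p div n) * S $$ (i, p mod n) * B $$ (p mod n, p div n))"
    using assms i
    by (auto simp: kronecker_def mat_of_row_def vectorize_def scalar_prod_def atLeast0LessThan
        mult.commute[of n k] less_mult_imp_div_less intro!: sum.cong)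
  also have "\<dots> = (\<Sum>j<k. \<Sum>p\<in>{j * n..<j * n + n}.
      y $ (p div n) * S $$ (i, p mod n) * B $$ (p mod n, p div n))"
    by (rule sum.nat_group[symmetric])
  also have "\<dots> = (\<Sum>j<k. \<Sum>p<n. y $ j * S $$ (i, p) * B $$ (p, j))"
  proof (rule sum.cong[OF refl])
    fix j
    have "(\<Sum>p\<in>{j * n..<j * n + n}. y $ (p div n) * S $$ (i, p mod n) * B $$ (p mod n, p div n))
      = (\<Sum>p\<in>{0..<n}. y $ ((p + j * n) div n) * S $$ (i, (p + j * n) mod n) *
           B $$ ((p + j * n) mod n, (p + j * n) div n))"
      using sum.shift_bounds_nat_ivl[of "\<lambda>p. y $ (p div n) * S $$ (i, p mod n) *
          B $$ (p mod n, p div n)" 0 "j * n" n]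
      by (simp add: add.commute)
    also have "\<dots> = (\<Sum>p<n. y $ j * S $$ (i, p) * B $$ (p, j))"
      by (auto simp: atLeast0LessThan intro!: sum.cong)
    finally show "(\<Sum>p\<in>{j * n..<j * n + n}. y $ (p div n) * S $$ (i, p mod n) *
        B $$ (p mod n, p div n)) = (\<Sum>p<n. y $ j * S $$ (i, p) * B $$ (p, j))" .
  qed
  also have "\<dots> = (\<Sum>p<n. \<Sum>j<k. y $ j * S $$ (i, p) * B $$ (p, j))"
    by (rule sum.swap)
  also have "\<dots> = (S *\<^sub>v (B *\<^sub>v y)) $ i"
    using assms i
    by (auto simp: scalar_prod_def atLeast0LessThan sum_distrib_left mult_ac intro!: sum.cong)
  finally show "((mat_of_row y \<otimes>\<^sub>k S) *\<^sub>v vectorize B) $ i = (S *\<^sub>v (B *\<^sub>v y)) $ i" .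
qed

end

theory Submission
  imports Defs
begin

text \<open>Up to the factor \<open>m\<close>, the squared Frobenius distance of the pairs \<open>(S, y)\<close> and \<open>(S_chk, y_chk)\<close> is
  \<open>|y|\<^sup>2 - 2 \<nu> <y, y_chk> + |y_chk|\<^sup>2\<close>, where \<open>\<nu>\<close> is the similarity of \<open>S\<close> and \<open>S_chk\<close>, and the isometry
  at \<open>H_chk\<close> says that the AltMin cost agrees with it up to the ratio \<open>\<varsigma>\<^sup>2 = 1 + \<epsilon>\<close>. Comparing the
  least-squares step with \<open>\<nu> y_chk\<close> keeps \<open>y\<close> close to \<open>\<nu> y_chk\<close>, so that above the threshold
  \<open>\<nu>_min\<close> one has \<open>2 <y, y_chk> > \<epsilon> (1 + \<nu>) |y_chk|\<^sup>2\<close>. Comparing the selection step with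
  \<open>S_chk\<close> then forces the next similarity to be strictly larger, unless \<open>\<nu> = 1\<close>. Since \<open>m \<nu>\<close> is an
  integer, \<open>\<nu> = 1\<close> after finitely many steps, and from then on \<open>y = y_chk\<close> exactly.\<close>

section \<open>Real inner products\<close>

lemma euclid_norm_power2: "(euclid_norm v)\<^sup>2 = v \<bullet> v"
  by (simp add: euclid_norm_def scalar_prod_def sum_nonneg)

lemma scalar_prod_self_ge_0: "0 \<le> (v :: real vec) \<bullet> v"
  by (simp add: scalar_prod_def sum_nonneg)

lemma scalar_prod_self_eq_0:
  fixes v :: "real vec"
  assumes "v \<in> carrier_vec k" "v \<bullet> v = 0"
  shows "v = 0\<^sub>v k"
  using assms by (auto simp: scalar_prod_def sum_nonneg_eq_0_iff)

lemma scalar_prod_diff_self: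
  fixes v w :: "real vec"
  assumes "v \<in> carrier_vec k" "w \<in> carrier_vec k"
  shows "(v - w) \<bullet> (v - w) = v \<bullet> v - 2 * (v \<bullet> w) + w \<bullet> w"
  using assms comm_scalar_prod[OF assms]
  by (simp add: minus_scalar_prod_distrib[of _ k] scalar_prod_minus_distrib[of _ k])

lemma scalar_prod_Cauchy_Schwarz:
  fixes v w :: "real vec"
  assumes v: "v \<in> carrier_vec k" and w: "w \<in> carrier_vec k"
  shows "(v \<bullet> w)\<^sup>2 \<le> (v \<bullet> v) * (w \<bullet> w)"
proof (cases "w \<bullet> w = 0")
  case True
  then have "w = 0\<^sub>v k" using w scalar_prod_self_eq_0 by blast
  then show ?thesis using v by simp
next
  case False
  then have pos: "w \<bullet> w > 0" using scalar_prod_self_ge_0[of w] by simp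
  \<comment> \<open>\<open>u\<close> is the component of \<open>v\<close> orthogonal to
    \<open>w\<close>, scaled by \<open>w \<bullet> w\<close> to avoid a division.\<close>
  define u where "u = (w \<bullet> w) \<cdot>\<^sub>v v - (v \<bullet> w) \<cdot>\<^sub>v w"
  have "0 \<le> u \<bullet> u" by (rule scalar_prod_self_ge_0)
  also have "u \<bullet> u = (w \<bullet> w) * ((v \<bullet> v) * (w \<bullet> w) - (v \<bullet> w)\<^sup>2)"
    using v w unfolding u_def
    by (subst scalar_prod_diff_self[of _ k])
      (auto simp: algebra_simps power2_eq_square)
  finally show ?thesis using pos by (simp add: zero_le_mult_iff)
qed

section \<open>Traces of products of selection matrices\<close>

lemma selection_matrices_carrier: "S \<in> selection_matrices m n \<Longrightarrow> S \<in> carrier_mat m n"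
  by (auto simp: selection_matrices_def)

lemma mat_trace_transpose_mult:
  assumes "S \<in> carrier_mat m n" "S' \<in> carrier_mat m n"
  shows "mat_trace (S\<^sup>T * S') = (\<Sum>i<m. \<Sum>p<n. S $$ (i, p) * S' $$ (i, p))"
  using assms sum.swap[of "\<lambda>p i. S $$ (i, p) * S' $$ (i, p)" "{..<m}" "{..<n}"]
  by (simp add: mat_trace_def scalar_prod_def atLeast0LessThan)

text \<open>Each row has a single 1, so the trace counts the rows on which the two index functions
  agree. Its integrality later turns strict growth of the similarity into termination.\<close>

lemma selection_matrices_trace:
  assumes "S \<in> selection_matrices m n" "S' \<in> selection_matrices m n"
  obtains c where "c \<le> m" "mat_trace (S\<^sup>T * S') = real c"
proof -
  obtain idx where idx: "idx ` {..<m} \<subseteq> {..<n}" "S = mat m n (\<lambda>(l, p). if p = idx l then 1 else 0)"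
    using assms(1) unfolding selection_matrices_def by blast
  obtain idx' where idx': "idx' ` {..<m} \<subseteq> {..<n}"
      "S' = mat m n (\<lambda>(l, p). if p = idx' l then 1 else 0)"
    using assms(2) unfolding selection_matrices_def by blast
  have "mat_trace (S\<^sup>T * S') = (\<Sum>i<m. \<Sum>p<n. S $$ (i, p) * S' $$ (i, p))"
    using assms by (intro mat_trace_transpose_mult selection_matrices_carrier)
  also have "\<dots> = (\<Sum>i<m. \<Sum>p<n. if p = idx i then (if idx i = idx' i then 1 else 0) else 0)"
    by (intro sum.cong) (auto simp: idx(2) idx'(2))
  also have "\<dots> = (\<Sum>i<m. if idx i = idx' i then 1 else 0)"
    using idx(1) by (intro sum.cong) (auto simp: sum.delta)
  also have "\<dots> = real (card {i \<in> {..<m}. idx i = idx' i})"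
    by (simp flip: sum.inter_filter)
  finally have "mat_trace (S\<^sup>T * S') = real (card {i \<in> {..<m}. idx i = idx' i})" .
  moreover have "card {i \<in> {..<m}. idx i = idx' i} \<le> m"
    by (rule order.trans[OF card_mono[of "{..<m}"]]) auto
  ultimately show ?thesis using that by blast
qed

lemma selection_matrices_trace_self:
  assumes "S \<in> selection_matrices m n"
  shows "mat_trace (S\<^sup>T * S) = real m"
proof -
  obtain idx where idx: "idx ` {..<m} \<subseteq> {..<n}" "S = mat m n (\<lambda>(l, p). if p = idx l then 1 else 0)"
    using assms unfolding selection_matrices_def by blast
  have "mat_trace (S\<^sup>T * S) = (\<Sum>i<m. \<Sum>p<n. S $$ (i, p) * S $$ (i, p))"
    using assms by (intro mat_trace_transpose_mult selection_matrices_carrier)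
  also have "\<dots> = (\<Sum>i<m. \<Sum>p<n. if p = idx i then 1 else 0)"
    by (intro sum.cong) (auto simp: idx(2))
  also have "\<dots> = (\<Sum>i<m. 1)"
    using idx(1) by (intro sum.cong) (auto simp: sum.delta)
  finally show ?thesis by simp
qed

section \<open>Frobenius distances and costs of Kronecker products\<close>

lemma frobenius_norm_diff_kronecker:
  assumes y: "y \<in> carrier_vec k" and y': "y' \<in> carrier_vec k"
    and S: "S \<in> carrier_mat m n" and S': "S' \<in> carrier_mat m n"
  shows "(frobenius_norm (mat_of_row y \<otimes>\<^sub>k S - mat_of_row y' \<otimes>\<^sub>k S'))\<^sup>2 =
    (y \<bullet> y) * mat_trace (S\<^sup>T * S) - 2 * (y \<bullet> y') * mat_trace (S\<^sup>T * S') +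
    (y' \<bullet> y') * mat_trace (S'\<^sup>T * S')"
proof -
  have "(frobenius_norm (mat_of_row y \<otimes>\<^sub>k S - mat_of_row y' \<otimes>\<^sub>k S'))\<^sup>2 =
      (\<Sum>i<m. \<Sum>p<k * n. (y $ (p div n) * S $$ (i, p mod n) - y' $ (p div n) * S' $$ (i, p mod n))\<^sup>2)"
    using y y' S S'
    by (auto simp: frobenius_norm_def sum_nonneg kronecker_def mat_of_row_def
        mult.commute[of n k] less_mult_imp_div_less intro!: sum.cong)
  also have "\<dots> = (\<Sum>i<m. \<Sum>j<k. \<Sum>p<n. (y $ j * S $$ (i, p) - y' $ j * S' $$ (i, p))\<^sup>2)"
  proof (rule sum.cong[OF refl])
    fix i
    let ?g = "\<lambda>j p. (y $ j * S $$ (i, p) - y' $ j * S' $$ (i, p))\<^sup>2"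
    \<comment> \<open>The \<open>k * n\<close> columns split into \<open>k\<close> blocks of length
      \<open>n\<close>: \<open>div\<close> gives the block, \<open>mod\<close> the position in
      it.\<close>
    have "(\<Sum>p<k * n. ?g (p div n) (p mod n)) =
        (\<Sum>j<k. \<Sum>p\<in>{j * n..<j * n + n}. ?g (p div n) (p mod n))"
      by (rule sum.nat_group[symmetric])
    also have "\<dots> = (\<Sum>j<k. \<Sum>p<n. ?g j p)"
    proof (rule sum.cong[OF refl])
      fix j
      have "(\<Sum>p\<in>{j * n..<j * n + n}. ?g (p div n) (p mod n)) =
          (\<Sum>p\<in>{0..<n}. ?g ((p + j * n) div n) ((p + j * n) mod n))"
        using sum.shift_bounds_nat_ivl[of "\<lambda>p. ?g (p div n) (p mod n)" 0 "j * n" n]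
        by (simp add: add.commute)
      also have "\<dots> = (\<Sum>p<n. ?g j p)"
        by (auto simp: atLeast0LessThan intro!: sum.cong)
      finally show "(\<Sum>p\<in>{j * n..<j * n + n}. ?g (p div n) (p mod n)) = (\<Sum>p<n. ?g j p)" .
    qed
    finally show "(\<Sum>p<k * n. ?g (p div n) (p mod n)) = (\<Sum>j<k. \<Sum>p<n. ?g j p)" .
  qed
  also have "\<dots> = (\<Sum>j<k. \<Sum>i<m. \<Sum>p<n. (y $ j * S $$ (i, p) - y' $ j * S' $$ (i, p))\<^sup>2)"
    by (rule sum.swap)
  \<comment> \<open>After expanding the square, the coefficients of y factor out for each j; the
    remaining sums over i and p are the traces.\<close>
  also have "\<dots> = (\<Sum>j<k. (y $ j * y $ j) * mat_trace (S\<^sup>T * S)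
      - 2 * (y $ j * y' $ j) * mat_trace (S\<^sup>T * S') + (y' $ j * y' $ j) * mat_trace (S'\<^sup>T * S'))"
    unfolding mat_trace_transpose_mult[OF S S] mat_trace_transpose_mult[OF S S']
      mat_trace_transpose_mult[OF S' S'] sum_distrib_left
      sum.distrib[symmetric] sum_subtractf[symmetric]
    by (intro sum.cong refl) (simp add: power2_eq_square algebra_simps)
  also have "\<dots> = (y \<bullet> y) * mat_trace (S\<^sup>T * S) - 2 * (y \<bullet> y') * mat_trace (S\<^sup>T * S') +
      (y' \<bullet> y') * mat_trace (S'\<^sup>T * S')"
    using y y' unfolding scalar_prod_def
    by (simp add: atLeast0LessThan sum_subtractf sum.distrib sum_distrib_left sum_distrib_right)
  finally show ?thesis .
qed

text \<open>This links the isometry to AltMin: the measured difference is the residual up to sign,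
  hence the expansions in both orders.\<close>

lemma altmin_cost_conv:
  assumes y: "y \<in> carrier_vec k" and y': "y' \<in> carrier_vec k"
    and S: "S \<in> carrier_mat m n" and S': "S' \<in> carrier_mat m n" and B: "B \<in> carrier_mat n k"
  shows "(euclid_norm ((mat_of_row y \<otimes>\<^sub>k S - mat_of_row y' \<otimes>\<^sub>k S') *\<^sub>v vectorize B))\<^sup>2 =
    altmin_cost B (S' *\<^sub>v (B *\<^sub>v y')) S y"
proof -
  have "(mat_of_row y \<otimes>\<^sub>k S - mat_of_row y' \<otimes>\<^sub>k S') *\<^sub>v vectorize B =
      (mat_of_row y \<otimes>\<^sub>k S) *\<^sub>v vectorize B - (mat_of_row y' \<otimes>\<^sub>k S') *\<^sub>v vectorize B"
    using y y' S S' B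
    by (intro minus_mult_distrib_mat_vec[of _ m "k * n"])
      (auto simp: kronecker_def vectorize_def mat_of_row_def mult.commute[of n k])
  also have "\<dots> = S *\<^sub>v (B *\<^sub>v y) - S' *\<^sub>v (B *\<^sub>v y')"
    using kronecker_row_mult_vectorize[OF y S B] kronecker_row_mult_vectorize[OF y' S' B] by simp
  moreover have "S *\<^sub>v (B *\<^sub>v y) \<in> carrier_vec m" "S' *\<^sub>v (B *\<^sub>v y') \<in> carrier_vec m"
    using S S' B y y' by auto
  ultimately show ?thesis
    using scalar_prod_diff_self[of "S *\<^sub>v (B *\<^sub>v y)" m "S' *\<^sub>v (B *\<^sub>v y')"]
      scalar_prod_diff_self[of "S' *\<^sub>v (B *\<^sub>v y')" m "S *\<^sub>v (B *\<^sub>v y)"]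
      comm_scalar_prod[of "S *\<^sub>v (B *\<^sub>v y)" m "S' *\<^sub>v (B *\<^sub>v y')"]
    by (simp add: altmin_cost_def euclid_norm_power2)
qed

section \<open>Scalar inequalities behind the threshold\<close>

lemma varsigma_power2:
  assumes "0 < \<delta>" "\<delta> < 1"
  shows "(varsigma \<delta>)\<^sup>2 = (1 + \<delta>) / (1 - \<delta>)"
  using assms by (simp add: varsigma_def)

text \<open>With u = \<open>sqrt (s\<^sup>2 - 1)\<close> and w = (1 - u)^2, the threshold is (1 - w)
  / (1 + w); clearing the positive denominator gives the claim.\<close>

lemma nu_min_threshold:
  assumes s: "1 \<le> s\<^sup>2" and \<nu>: "nu_min s < \<nu>"
  shows "1 - \<nu> < (1 - sqrt (s\<^sup>2 - 1))\<^sup>2 * (1 + \<nu>)"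
proof -
  define u where "u = sqrt (s\<^sup>2 - 1)"
  have s2: "s\<^sup>2 = 1 + u\<^sup>2" unfolding u_def using s by (subst real_sqrt_pow2) auto
  have den: "1 + s\<^sup>2 - 2 * u = 1 + (1 - u)\<^sup>2"
    unfolding s2 by (simp add: power2_eq_square algebra_simps)
  have "(1 - s\<^sup>2 + 2 * u) / (1 + (1 - u)\<^sup>2) < \<nu>"
    using \<nu> unfolding nu_min_def u_def[symmetric] den .
  moreover have "1 + (1 - u)\<^sup>2 > 0" by (smt (verit) zero_le_power2)
  ultimately have "1 - s\<^sup>2 + 2 * u < \<nu> * (1 + (1 - u)\<^sup>2)"
    by (simp add: pos_divide_less_eq)
  then have "1 - \<nu> < (1 - u)\<^sup>2 * (1 + \<nu>)"
    unfolding s2 by (simp add: power2_eq_square algebra_simps)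
  then show ?thesis by (simp only: u_def)
qed

text \<open>In terms of \<open>p = sqrt (1 + \<nu>)\<close>, \<open>q = sqrt (1 - \<nu>)\<close> and \<open>u = sqrt \<epsilon>\<close> the hypothesis reads
  \<open>q + u p < p\<close>, and the claim is \<open>(q + u p)\<^sup>2 < p\<^sup>2\<close>.\<close>

lemma correlation_margin:
  fixes \<nu> \<epsilon> :: real
  assumes \<nu>: "0 \<le> \<nu>" "\<nu> \<le> 1" and \<epsilon>: "0 \<le> \<epsilon>" "\<epsilon> < 1"
    and thr: "1 - \<nu> < (1 - sqrt \<epsilon>)\<^sup>2 * (1 + \<nu>)"
  shows "\<epsilon> * (1 + \<nu>) / 2 < \<nu> - sqrt (\<epsilon> * (1 - \<nu>\<^sup>2))"
proof -
  define p q u where "p = sqrt (1 + \<nu>)" and "q = sqrt (1 - \<nu>)" and "u = sqrt \<epsilon>"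
  have p: "p\<^sup>2 = 1 + \<nu>" "0 \<le> p" and q: "q\<^sup>2 = 1 - \<nu>" "0 \<le> q" and u: "u\<^sup>2 = \<epsilon>" "0 \<le> u" "u < 1"
    using \<nu> \<epsilon> by (auto simp: p_def q_def u_def)
  have "q\<^sup>2 < ((1 - u) * p)\<^sup>2"
    using thr unfolding u_def[symmetric] power_mult_distrib p q .
  \<comment> \<open>Taking roots needs 1 - u to be nonnegative, which is where
    \<open>\<epsilon> < 1\<close> enters.\<close>
  then have "q < (1 - u) * p"
    using p u by (intro power2_less_imp_less[of q]) auto
  then have "q + u * p < p" by (simp add: algebra_simps)
  then have "(q + u * p)\<^sup>2 < p\<^sup>2"
    using p q u by (intro power_strict_mono) auto
  then have "u\<^sup>2 * p\<^sup>2 + 2 * (u * p * q) < p\<^sup>2 - q\<^sup>2"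
    by (simp add: power2_eq_square algebra_simps)
  then have "\<epsilon> * (1 + \<nu>) + 2 * (u * p * q) < (1 + \<nu>) - (1 - \<nu>)"
    unfolding p q u .
  moreover have "sqrt (\<epsilon> * (1 - \<nu>\<^sup>2)) = u * p * q"
  proof -
    have "\<epsilon> * (1 - \<nu>\<^sup>2) = \<epsilon> * (1 + \<nu>) * (1 - \<nu>)"
      by (simp add: power2_eq_square algebra_simps)
    then show ?thesis by (simp only: real_sqrt_mult p_def q_def u_def)
  qed
  ultimately show ?thesis by linarith
qed

text \<open>Here \<open>N\<close>, \<open>a\<close>, \<open>Y\<close> stand for the products of y
  with y, of y with y_chk, and of y_chk with itself. Cauchy-Schwarz replaces \<open>N\<close> by the
  part along y_chk; completing the square then confines a / Y to a neighbourhood of \<nu>.\<close>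

lemma least_squares_correlation:
  fixes N a Y \<nu> \<epsilon> :: real
  assumes Y: "0 < Y" and CS: "a\<^sup>2 \<le> N * Y"
    and \<nu>: "0 \<le> \<nu>" "\<nu> \<le> 1" and \<epsilon>: "0 \<le> \<epsilon>" "\<epsilon> < 1"
    and thr: "1 - \<nu> < (1 - sqrt \<epsilon>)\<^sup>2 * (1 + \<nu>)"
    and ls: "N - 2 * \<nu> * a + Y \<le> (1 + \<epsilon>) * (1 - \<nu>\<^sup>2) * Y"
  shows "\<epsilon> * (1 + \<nu>) * Y < 2 * a"
proof -
  define \<alpha> where "\<alpha> = a / Y"
  have a: "a = \<alpha> * Y" using Y by (simp add: \<alpha>_def)
  have "\<alpha>\<^sup>2 * Y * Y \<le> N * Y" using CS by (simp add: a power2_eq_square mult_ac)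
  then have "\<alpha>\<^sup>2 * Y \<le> N" using Y by simp
  then have "\<alpha>\<^sup>2 * Y - 2 * \<nu> * (\<alpha> * Y) + Y \<le> (1 + \<epsilon>) * (1 - \<nu>\<^sup>2) * Y"
    using ls a by simp
  then have "(\<alpha> - \<nu>)\<^sup>2 * Y \<le> (\<epsilon> * (1 - \<nu>\<^sup>2)) * Y"
    by (simp add: power2_eq_square algebra_simps)
  then have "(\<alpha> - \<nu>)\<^sup>2 \<le> \<epsilon> * (1 - \<nu>\<^sup>2)" using Y by simp
  then have "\<bar>\<alpha> - \<nu>\<bar> \<le> sqrt (\<epsilon> * (1 - \<nu>\<^sup>2))"
    by (rule real_le_rsqrt[of "\<bar>\<alpha> - \<nu>\<bar>", simplified])
  then have "\<epsilon> * (1 + \<nu>) / 2 < \<alpha>"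
    using correlation_margin[OF \<nu> \<epsilon> thr] by linarith
  then show ?thesis using Y by (simp add: \<alpha>_def field_simps)
qed

text \<open>The two steps combine to 2 a (1 - \<nu>') \<le> (1 - \<nu>) K, and the correlation bound
  makes K smaller than 2 a, so the gap to 1 shrinks strictly unless it is already closed.\<close>

lemma similarity_progress:
  fixes N a Y \<nu> \<nu>' \<epsilon> :: real
  assumes Y: "0 < Y" and \<nu>: "0 \<le> \<nu>" "\<nu> \<le> 1" and \<epsilon>: "0 \<le> \<epsilon>"
    and corr: "\<epsilon> * (1 + \<nu>) * Y < 2 * a"
    and ls: "N - 2 * \<nu> * a + Y \<le> (1 + \<epsilon>) * (1 - \<nu>\<^sup>2) * Y"
    and sel: "N - 2 * \<nu>' * a + Y \<le> (1 + \<epsilon>) * (N - 2 * a + Y)"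
  shows "\<nu> = 1 \<and> 1 \<le> \<nu>' \<or> \<nu> < \<nu>'"
proof -
  have a: "0 < a" using corr \<epsilon> \<nu> Y by (smt (verit) mult_nonneg_nonneg)
  have "2 * a * (1 - \<nu>') \<le> \<epsilon> * (N - 2 * a + Y)"
    using sel by (simp add: algebra_simps)
  \<comment> \<open>Write N - 2 a + Y as (N - 2 \<nu> a + Y) - 2 (1 - \<nu>) a and apply
    \<open>ls\<close>; both terms then carry the factor 1 - \<nu>.\<close>
  also have "\<dots> \<le> \<epsilon> * ((1 - \<nu>) * ((1 + \<epsilon>) * (1 + \<nu>) * Y - 2 * a))"
    using ls \<epsilon> by (intro mult_left_mono) (simp_all add: power2_eq_square algebra_simps)
  finally have le: "2 * a * (1 - \<nu>') \<le> (1 - \<nu>) * (\<epsilon> * ((1 + \<epsilon>) * (1 + \<nu>) * Y - 2 * a))"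
    by (simp add: mult_ac)
  have lt: "\<epsilon> * ((1 + \<epsilon>) * (1 + \<nu>) * Y - 2 * a) < 2 * a"
  proof -
    have "(1 + \<epsilon>) * (\<epsilon> * (1 + \<nu>) * Y) < (1 + \<epsilon>) * (2 * a)"
      using corr \<epsilon> by (intro mult_strict_left_mono) auto
    then show ?thesis by (simp add: algebra_simps)
  qed
  show ?thesis
  proof (cases "\<nu> = 1")
    case True
    then have "2 * a * (1 - \<nu>') \<le> 0" using le by simp
    then show ?thesis using a True by (simp add: mult_le_0_iff)
  next
    case False
    then have "(1 - \<nu>) * (\<epsilon> * ((1 + \<epsilon>) * (1 + \<nu>) * Y - 2 * a)) < (1 - \<nu>) * (2 * a)"
      using lt \<nu> by (intro mult_strict_left_mono) auto
    then have "2 * a * (1 - \<nu>') < 2 * a * (1 - \<nu>)" using le by (simp add: mult_ac)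
    then show ?thesis using a by simp
  qed
qed

section \<open>Limits of the threshold\<close>

lemma isCont_nu_min: "isCont nu_min 1"
  \<comment> \<open>Two-sided continuity makes sense because \<open>sqrt\<close> is continuous on
    all reals; the denominator is 2 at the point 1.\<close>
  unfolding nu_min_def by (intro continuous_intros) simp

lemma tendsto_nu_min: "(nu_min \<longlongrightarrow> 0) (at_right 1)"
proof -
  have "(nu_min \<longlongrightarrow> nu_min 1) (at 1)" using isCont_nu_min by (simp add: isCont_def)
  then show ?thesis by (simp add: nu_min_def filterlim_at_split)
qed

lemma tendsto_nu_min_varsigma: "((\<lambda>d. nu_min (varsigma d)) \<longlongrightarrow> 0) (at_right 0)"
proof -
  have "isCont varsigma 0" unfolding varsigma_def by (intro continuous_intros) simp
  moreover have "varsigma 0 = 1" by (simp add: varsigma_def)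
  ultimately have "isCont (\<lambda>d. nu_min (varsigma d)) 0"
    using isCont_nu_min by (simp only: isCont_o2[of 0 varsigma nu_min])
  then have "((\<lambda>d. nu_min (varsigma d)) \<longlongrightarrow> nu_min (varsigma 0)) (at 0)"
    by (simp add: isCont_def)
  then show ?thesis by (simp add: nu_min_def varsigma_def filterlim_at_split)
qed

section \<open>Convergence of the alternating minimization\<close>

theorem theorem6:
  fixes k m n :: nat and \<delta> \<mu> :: real
    and B S_chk H_chk :: "real mat" and y_chk :: "real vec"
  assumes "k > 0" and "m > 0" and "n > 0" and "m \<le> n"
    and "0 < \<delta>" and "\<delta> < 1 / 3" and "\<mu> > 0"
    and "B \<in> carrier_mat n k"
    and "R_RIP (H_set k m n) (vectorize B) \<delta> \<mu>"
    and "y_chk \<in> carrier_vec k" and "S_chk \<in> selection_matrices m n"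
    and "H_chk = mat_of_row y_chk \<otimes>\<^sub>k S_chk"
    and "\<forall>H\<in>H_set k m n.
       (1 - \<delta>) * (frobenius_norm (H - H_chk))\<^sup>2 \<le> (euclid_norm ((H - H_chk) *\<^sub>v vectorize B))\<^sup>2 \<and>
       (euclid_norm ((H - H_chk) *\<^sub>v vectorize B))\<^sup>2 \<le> (1 + \<delta>) * (frobenius_norm (H - H_chk))\<^sup>2"
  shows "((\<lambda>d. nu_min (varsigma d)) \<longlongrightarrow> 0) (at_right 0) \<and>
         (nu_min \<longlongrightarrow> 0) (at_right 1) \<and>
         (\<forall>(x_chk :: real vec) (S :: nat \<Rightarrow> real mat) (y :: nat \<Rightarrow> real vec).
            x_chk = S_chk *\<^sub>v (B *\<^sub>v y_chk) \<longrightarrow>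
            altmin_sequence k m n B x_chk S y \<longrightarrow>
            similarity m (S 1) S_chk > nu_min (varsigma \<delta>) \<longrightarrow>
            (\<lambda>t. euclid_norm (y_chk - y t)) \<longlonglongrightarrow> 0)"
proof (intro conjI allI impI)
  show "((\<lambda>d. nu_min (varsigma d)) \<longlongrightarrow> 0) (at_right 0)" by (rule tendsto_nu_min_varsigma)
  show "(nu_min \<longlongrightarrow> 0) (at_right 1)" by (rule tendsto_nu_min)
next
  fix x_chk :: "real vec" and S :: "nat \<Rightarrow> real mat" and y :: "nat \<Rightarrow> real vec"
  assume x_chk: "x_chk = S_chk *\<^sub>v (B *\<^sub>v y_chk)"
    and alt: "altmin_sequence k m n B x_chk S y"
    and init: "similarity m (S 1) S_chk > nu_min (varsigma \<delta>)"
  note m = \<open>m > 0\<close> and \<delta> = \<open>0 < \<delta>\<close> \<open>\<delta> < 1 / 3\<close> and B = \<open>B \<in> carrier_mat n k\<close>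
    and y_chk = \<open>y_chk \<in> carrier_vec k\<close> and S_chk = \<open>S_chk \<in> selection_matrices m n\<close>
  define \<epsilon> where "\<epsilon> = (varsigma \<delta>)\<^sup>2 - 1"
  have e1: "1 + \<epsilon> = (1 + \<delta>) / (1 - \<delta>)" using varsigma_power2[of \<delta>] \<delta> by (simp add: \<epsilon>_def)
  then have e2: "1 + \<delta> = (1 + \<epsilon>) * (1 - \<delta>)"
    using \<delta> by simp
  \<comment> \<open>In this form \<open>\<epsilon> < 1\<close> is exactly
    \<open>\<delta> < 1 / 3\<close>.\<close>
  have "\<epsilon> = 2 * \<delta> / (1 - \<delta>)" using e1 \<delta> by (simp add: field_simps)
  then have \<epsilon>: "0 \<le> \<epsilon>" "\<epsilon> < 1" using \<delta> by simp_all
  define Y where "Y = y_chk \<bullet> y_chk"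
  define \<nu> where "\<nu> T = similarity m T S_chk" for T
  define D where "D T z = z \<bullet> z - 2 * \<nu> T * (z \<bullet> y_chk) + Y" for T z
  have cost: "(1 - \<delta>) * (m * D T z) \<le> altmin_cost B x_chk T z"
             "altmin_cost B x_chk T z \<le> (1 + \<delta>) * (m * D T z)"
    if T: "T \<in> selection_matrices m n" and z: "z \<in> carrier_vec k" for T z
  proof -
    have "mat_of_row z \<otimes>\<^sub>k T \<in> H_set k m n"
      using T z unfolding H_set_def by blast
    moreover have "mat_trace (T\<^sup>T * S_chk) = m * \<nu> T"
      using m by (simp add: \<nu>_def similarity_def)
    then have "(frobenius_norm (mat_of_row z \<otimes>\<^sub>k T - H_chk))\<^sup>2 = m * D T z"
      unfolding \<open>H_chk = _\<close>
      using frobenius_norm_diff_kronecker[OF z y_chk selection_matrices_carrier[OF T]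
          selection_matrices_carrier[OF S_chk]]
        selection_matrices_trace_self[OF T] selection_matrices_trace_self[OF S_chk]
      by (simp add: D_def Y_def algebra_simps)
    moreover have "(euclid_norm ((mat_of_row z \<otimes>\<^sub>k T - H_chk) *\<^sub>v vectorize B))\<^sup>2 =
        altmin_cost B x_chk T z"
      unfolding \<open>H_chk = _\<close> x_chk
      by (rule altmin_cost_conv[OF z y_chk selection_matrices_carrier[OF T]
          selection_matrices_carrier[OF S_chk] B])
    ultimately show "(1 - \<delta>) * (m * D T z) \<le> altmin_cost B x_chk T z"
        "altmin_cost B x_chk T z \<le> (1 + \<delta>) * (m * D T z)"
      using assms(13) by fastforce+
  qed
  have D_le: "D T z \<le> (1 + \<epsilon>) * D T' z'"
    if "T \<in> selection_matrices m n" "z \<in> carrier_vec k"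
      "T' \<in> selection_matrices m n" "z' \<in> carrier_vec k"
      "altmin_cost B x_chk T z \<le> altmin_cost B x_chk T' z'" for T z T' z'
  proof -
    have "(1 - \<delta>) * (m * D T z) \<le> (1 + \<delta>) * (m * D T' z')"
      using cost(1)[OF that(1,2)] cost(2)[OF that(3,4)] that(5) by linarith
    then have "((1 - \<delta>) * m) * D T z \<le> ((1 - \<delta>) * m) * ((1 + \<epsilon>) * D T' z')"
      unfolding e2 by (simp only: mult_ac)
    moreover have "(1 - \<delta>) * m > 0" using m \<delta> by simp
    ultimately show ?thesis by (rule mult_left_le_imp_le)
  qed
  \<comment> \<open>The start is feasible by definition; each later \<open>S t\<close> is feasible
    as a minimizer chosen at \<open>t - 1\<close>.\<close>
  have S: "S t \<in> selection_matrices m n" if "1 \<le> t" for t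
    using alt that by (cases "t = 1") (auto simp: altmin_sequence_def is_arg_min_def
        dest!: spec[of _ "t - 1"])
  have y: "y t \<in> carrier_vec k" if "1 \<le> t" for t
    using alt that by (simp add: altmin_sequence_def is_arg_min_def)
  have y_step: "altmin_cost B x_chk (S t) (y t) \<le> altmin_cost B x_chk (S t) z"
    if "1 \<le> t" "z \<in> carrier_vec k" for t z
    using alt that by (auto simp: altmin_sequence_def is_arg_min_def not_less)
  have S_step: "altmin_cost B x_chk (S (t + 1)) (y t) \<le> altmin_cost B x_chk T (y t)"
    if "1 \<le> t" "T \<in> selection_matrices m n" for t T
    using alt that by (auto simp: altmin_sequence_def is_arg_min_def not_less)
  have \<nu>_chk: "\<nu> S_chk = 1"
    using selection_matrices_trace_self[OF S_chk] m by (simp add: \<nu>_def similarity_def)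
  have ls: "y t \<bullet> y t - 2 * \<nu> (S t) * (y t \<bullet> y_chk) + Y \<le> (1 + \<epsilon>) * (1 - (\<nu> (S t))\<^sup>2) * Y"
    if t: "1 \<le> t" for t
  proof -
    \<comment> \<open>The comparison vector is the exact minimizer of \<open>D (S t)\<close>, as
      seen by completing the square.\<close>
    have "D (S t) (y t) \<le> (1 + \<epsilon>) * D (S t) (\<nu> (S t) \<cdot>\<^sub>v y_chk)"
      using t y_chk by (intro D_le S y y_step) auto
    also have "D (S t) (\<nu> (S t) \<cdot>\<^sub>v y_chk) = (1 - (\<nu> (S t))\<^sup>2) * Y"
      using y_chk by (simp add: D_def Y_def power2_eq_square algebra_simps)
    finally show ?thesis by (simp add: D_def mult_ac)
  qed
  have sel: "y t \<bullet> y t - 2 * \<nu> (S (t + 1)) * (y t \<bullet> y_chk) + Y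
      \<le> (1 + \<epsilon>) * (y t \<bullet> y t - 2 * (y t \<bullet> y_chk) + Y)" if t: "1 \<le> t" for t
  proof -
    have "D (S (t + 1)) (y t) \<le> (1 + \<epsilon>) * D S_chk (y t)"
      using t S_chk by (intro D_le S y S_step) auto
    then show ?thesis by (simp add: D_def \<nu>_chk)
  qed
  have dist: "(euclid_norm (y_chk - y t))\<^sup>2 = y t \<bullet> y t - 2 * (y t \<bullet> y_chk) + Y" if "1 \<le> t" for t
    using scalar_prod_diff_self[OF y_chk y[OF that]] comm_scalar_prod[OF y_chk y[OF that]]
    by (simp add: euclid_norm_power2 Y_def)
  have "eventually (\<lambda>t. euclid_norm (y_chk - y t) = 0) sequentially"
  proof (cases "Y = 0")
    case True
    then have y0: "y_chk = 0\<^sub>v k" using scalar_prod_self_eq_0[OF y_chk] by (simp add: Y_def)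
    \<comment> \<open>For y_chk = 0, \<open>ls\<close> says that the squared norm of
      \<open>y t\<close> is at most 0.\<close>
    have "(euclid_norm (y_chk - y t))\<^sup>2 \<le> 0" if t: "1 \<le> t" for t
      using ls[OF t] dist[OF t] y[OF t] True y0 by simp
    then show ?thesis by (auto simp: eventually_sequentially)
  next
    case False
    then have Y: "0 < Y" using scalar_prod_self_ge_0[of y_chk] by (simp add: Y_def)
    have "\<exists>c\<le>m. \<nu> (S t) = c / m" if "1 \<le> t" for t
      using selection_matrices_trace[OF S[OF that] S_chk] by (metis \<nu>_def similarity_def)
    then obtain c where c: "\<And>t. 1 \<le> t \<Longrightarrow> c t \<le> m" "\<And>t. 1 \<le> t \<Longrightarrow> \<nu> (S t) = c t / m"
      by metis
    have \<nu>01: "0 \<le> \<nu> (S t)" "\<nu> (S t) \<le> 1" if "1 \<le> t" for t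
      using c[OF that] m by auto
    have progress: "\<nu> (S t) = 1 \<and> 1 \<le> \<nu> (S (t + 1)) \<or> \<nu> (S t) < \<nu> (S (t + 1))"
      if t: "1 \<le> t" and above: "nu_min (varsigma \<delta>) < \<nu> (S t)" for t
    proof (rule similarity_progress[OF Y \<nu>01[OF t] \<epsilon>(1) _ ls[OF t] sel[OF t]])
      have "1 - \<nu> (S t) < (1 - sqrt \<epsilon>)\<^sup>2 * (1 + \<nu> (S t))"
        using nu_min_threshold[OF _ above] \<epsilon> by (simp add: \<epsilon>_def)
      then show "\<epsilon> * (1 + \<nu> (S t)) * Y < 2 * (y t \<bullet> y_chk)"
        using scalar_prod_Cauchy_Schwarz[OF y[OF t] y_chk]
        by (intro least_squares_correlation[OF Y _ \<nu>01[OF t] \<epsilon> _ ls[OF t]]) (simp_all add: Y_def)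
    qed
    \<comment> \<open>The similarity never decreases, so the threshold condition is inherited from
      the start.\<close>
    have above: "nu_min (varsigma \<delta>) < \<nu> (S t)" if "1 \<le> t" for t
      using that
    proof (induction t rule: dec_induct)
      case base
      then show ?case using init by (simp add: \<nu>_def)
    next
      case (step t)
      then show ?case using progress[of t] by auto
    qed
    \<comment> \<open>The number of common rows is an integer, so it reaches \<open>m\<close> after finitely many steps.\<close>
    have count: "min m t \<le> c (t + 1)" for t
    proof (induction t)
      case (Suc t)
      have "c (t + 1) = m \<and> m \<le> c (t + 2) \<or> c (t + 1) < c (t + 2)"
        using progress[of "t + 1"] above[of "t + 1"] m
        by (auto simp: c(2) divide_less_cancel)
      then show ?case using Suc by auto
    qed simp
    \<comment> \<open>The shift by 1 reflects that iterates start at 1. Once \<nu> = 1, the right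
      side of \<open>ls\<close> vanishes and its left side is the squared distance.\<close>
    have "(euclid_norm (y_chk - y t))\<^sup>2 \<le> 0" if t: "m + 1 \<le> t" for t
    proof -
      have "c t = m" using count[of "t - 1"] c(1)[of t] t by simp
      then have "\<nu> (S t) = 1" using c(2)[of t] t m by simp
      then show ?thesis using ls[of t] dist[of t] t by simp
    qed
    then show ?thesis by (auto simp: eventually_sequentially)
  qed
  then show "(\<lambda>t. euclid_norm (y_chk - y t)) \<longlonglongrightarrow> 0"
    by (rule tendsto_eventually)
qed

end
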